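(* Let $\alpha\in(0,1/2)$, $\delta\in(0,1]$, $R>0$, and $\rho=1-\alpha\delta$. Consider the opinion dynamics on the graph $G=(V,E)$, $V=\{1,\dots,n\}$, given for $t\in\mathbb{N}$ by $$x_i(t+1)=\begin{cases} x_i(t)+\dfrac{\alpha}{|N_i(t)|}\displaystyle\sum_{j\in N_i(t)}(x_j(t)-x_i(t)) & \text{if } N_i(t)\neq\emptyset,\\ x_i(t) & \text{if } N_i(t)=\emptyset,\end{cases}$$ where $N_i(t)=\{j\in V\mid (i,j)\in E \text{ and } |x_i(t)-x_j(t)|\le R\rho^t\}$, with $x(0)=x^0$. Then for almost all (with respect to Lebesgue measure on $\mathbb{R}^n$) vectors of initial opinions $x^0\in\mathbb{R}^n$, the following holds: if the trajectory starting from $x^0$ satisfies the fast convergence assumption, then the set of communities $\mathscr{C}$ is a partition of $V$ such that for all $I\in\mathscr{C}$ with $|I|\ge 2$, $\mu_2(L(G_I))>\delta$.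
   Context: $G=(V,E)$ is an undirected graph with $V=\{1,\dots,n\}$, $n\ge 2$, and $E\subseteq V\times V$ symmetric and anti-reflexive; $\mathbb{N}=\{0,1,2,\dots\}$. For the dynamics in the claim, each sequence $(x_i(t))_{t\in\mathbb{N}}$ converges; its limit is denoted $x_i^*$. Fast convergence assumption (for a trajectory): there exist $\underline{\rho}<\rho$ and $M\ge 0$ such that for all $i\in V$ and all $t\in\mathbb{N}$, $|x_i(t)-x_i^*|\le M\underline{\rho}^t$. Communities are the classes of the equivalence relation $i\sim^* j\iff x_i^*=x_j^*$ on $V$; $\mathscr{C}=V/\!\sim^*$ is the set of communities (depending on $x^0$). For $I\subseteq V$, $G_I=(I,E_I)$ with $E_I=E\cap(I\times I)$ is the induced subgraph. For a graph $H$ with at least two vertices and edge relation $E_H$, $d_i(H)$ denotes the degree (number of neighbors) of vertex $i$ in $H$, and the normalized Laplacian $L(H)$ is the symmetric matrix with entries $L_{ij}(H)=1$ if $i=j$ and $d_i(H)\neq0$; $L_{ij}(H)=-1/\sqrt{d_i(H)d_j(H)}$ if $(i,j)\in E_H$; and $L_{ij}(H)=0$ otherwise. Its eigenvalues are real and nonnegative, the smallest one being $0$; $\mu_2(L(H))$ denotes the second smallest eigenvalue, counted with multiplicity. *)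

theory Defs
  imports
    "HOL-Analysis.Finite_Product_Measure"
    "HOL-Analysis.Lebesgue_Measure"
    "HOL-Library.Disjoint_Sets"
    "Jordan_Normal_Form.Char_Poly"
begin

definition nbrs ::
  "nat set \<Rightarrow> (nat \<times> nat) set \<Rightarrow> real \<Rightarrow> (nat \<Rightarrow> real) \<Rightarrow> nat \<Rightarrow> nat set" where
  "nbrs V E r x i = {j \<in> V. (i, j) \<in> E \<and> \<bar>x i - x j\<bar> \<le> r}"

primrec opinion ::
  "nat set \<Rightarrow> (nat \<times> nat) set \<Rightarrow> real \<Rightarrow> real \<Rightarrow> real \<Rightarrow> (nat \<Rightarrow> real) \<Rightarrow> nat \<Rightarrow> nat \<Rightarrow> real" where
  "opinion V E \<alpha> R \<rho> x0 0 = x0"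
| "opinion V E \<alpha> R \<rho> x0 (Suc t) =
    (\<lambda>i. let x = opinion V E \<alpha> R \<rho> x0 t; N = nbrs V E (R * \<rho> ^ t) x i in
      if N \<noteq> {} then x i + \<alpha> / real (card N) * (\<Sum>j\<in>N. x j - x i) else x i)"

definition limit_opinion ::
  "nat set \<Rightarrow> (nat \<times> nat) set \<Rightarrow> real \<Rightarrow> real \<Rightarrow> real \<Rightarrow> (nat \<Rightarrow> real) \<Rightarrow> nat \<Rightarrow> real" where
  "limit_opinion V E \<alpha> R \<rho> x0 i = lim (\<lambda>t. opinion V E \<alpha> R \<rho> x0 t i)"

definition fast_convergence ::
  "nat set \<Rightarrow> (nat \<times> nat) set \<Rightarrow> real \<Rightarrow> real \<Rightarrow> real \<Rightarrow> (nat \<Rightarrow> real) \<Rightarrow> bool" where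
  "fast_convergence V E \<alpha> R \<rho> x0 \<longleftrightarrow>
    (\<exists>\<rho>' M. \<rho>' < \<rho> \<and> M \<ge> 0 \<and>
      (\<forall>i\<in>V. \<forall>t. \<bar>opinion V E \<alpha> R \<rho> x0 t i - limit_opinion V E \<alpha> R \<rho> x0 i\<bar> \<le> M * \<rho>' ^ t))"

definition communities ::
  "nat set \<Rightarrow> (nat \<times> nat) set \<Rightarrow> real \<Rightarrow> real \<Rightarrow> real \<Rightarrow> (nat \<Rightarrow> real) \<Rightarrow> nat set set" where
  "communities V E \<alpha> R \<rho> x0 =
    V // {(i, j) \<in> V \<times> V. limit_opinion V E \<alpha> R \<rho> x0 i = limit_opinion V E \<alpha> R \<rho> x0 j}"

definition induced_edges :: "(nat \<times> nat) set \<Rightarrow> nat set \<Rightarrow> (nat \<times> nat) set" where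
  "induced_edges E I = E \<inter> (I \<times> I)"

definition vertex_degree :: "nat set \<Rightarrow> (nat \<times> nat) set \<Rightarrow> nat \<Rightarrow> nat" where
  "vertex_degree W F i = card {j \<in> W. (i, j) \<in> F}"

definition laplacian_entry :: "nat set \<Rightarrow> (nat \<times> nat) set \<Rightarrow> nat \<Rightarrow> nat \<Rightarrow> real" where
  "laplacian_entry W F i j =
    (if i = j \<and> vertex_degree W F i \<noteq> 0 then 1
     else if (i, j) \<in> F
       then - 1 / sqrt (real (vertex_degree W F i) * real (vertex_degree W F j))
     else 0)"

(* Rows and columns follow the increasing enumeration of the finite vertex set W. *)
definition normalized_laplacian :: "nat set \<Rightarrow> (nat \<times> nat) set \<Rightarrow> real mat" where
  "normalized_laplacian W F =
    mat (card W) (card W)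
      (\<lambda>(a, b). laplacian_entry W F (sorted_list_of_set W ! a) (sorted_list_of_set W ! b))"

(* The real roots of the characteristic polynomial, listed in increasing order and repeated
   according to multiplicity; a symmetric real matrix of dimension k has k of them.  List
   positions start at 0, so position 1 holds the second smallest eigenvalue. *)
definition \<mu>\<^sub>2 :: "real mat \<Rightarrow> real" where
  "\<mu>\<^sub>2 A = sorted_list_of_multiset (proots (char_poly A)) ! 1"

end

theory Submission
  imports Defs "Jordan_Normal_Form.Schur_Decomposition"
begin

text \<open>
  Under fast convergence two opinions with the same limit approach each other like \<open>r ^ t\<close> with
  \<open>r < \<rho>\<close>, hence eventually faster than the confidence radius \<open>R * \<rho> ^ t\<close> shrinks, while two opinions
  with different limits stay apart and the radius tends to zero.  From some time on, the neighbours
  of an agent are therefore exactly its graph neighbours inside its own community \<open>I\<close>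
  (\<open>eventually_close_iff_same_limit\<close>), and on \<open>I\<close> the dynamics is the linear map
  \<open>x \<mapsto> x - \<alpha> L x\<close>, where \<open>L\<close> is the random walk Laplacian of the graph induced on \<open>I\<close>.

  Suppose that \<open>\<mu>\<^sub>2 \<le> \<delta>\<close> for this graph.  The random walk Laplacian is similar to the normalized one,
  so an eigenvector of the latter that is orthogonal to its canonical null vector turns into a
  nonzero linear functional \<open>\<phi>\<close> that vanishes on constant vectors and is multiplied by
  \<open>1 - \<alpha> * \<mu> \<ge> 1 - \<alpha> * \<delta> = \<rho>\<close> in every step (\<open>laplacian_eigenfunctional\<close>).  As the limit is constant on
  \<open>I\<close>, fast convergence gives \<open>\<phi> (x t) = O (r ^ t)\<close>.  A quantity cannot grow by a factor of at least \<open>\<rho>\<close>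
  in each step and be \<open>O (r ^ t)\<close> unless it is zero, so \<open>\<phi> (x t) = 0\<close> from some time on.

  For almost all initial opinions this never happens.  Each step is one of finitely many
  averaging maps, and \<open>\<alpha> < 1 / 2\<close> makes all of them invertible
  (\<open>averaging_step_pullback\<close>).  Hence pulling \<open>\<phi>\<close> back to time 0 yields, for each
  \<open>t\<close>, one of finitely many nonzero functionals, whose kernels are hyperplanes and thus null sets
  (\<open>AE_opinion_avoids_hyperplane\<close>).  There are only finitely many sets \<open>I\<close> to exclude.
\<close>

unbundle no vec_syntax
unbundle no inner_syntax

section \<open>Hyperplanes are null sets\<close>

text \<open>
  If the \<open>k\<close>-th coefficient is nonzero, every line parallel to the \<open>k\<close>-th axis meets the kernel
  in a single point, so the kernel is null by Fubini.
\<close>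

lemma AE_linear_functional_nonzero:
  fixes c :: "'a \<Rightarrow> real"
  assumes "finite V" "k \<in> V" "c k \<noteq> 0"
  shows "AE x in (\<Pi>\<^sub>M i\<in>V. lborel). (\<Sum>i\<in>V. c i * x i) \<noteq> 0"
proof -
  interpret product_sigma_finite "\<lambda>_::'a. lborel :: real measure"
    by standard
  define W where "W = V - {k}"
  have W: "finite W" "k \<notin> W" and V: "V = insert k W"
    using assms unfolding W_def by auto
  let ?M = "\<Pi>\<^sub>M i\<in>insert k W. (lborel :: real measure)"
  let ?H = "{x \<in> space ?M. (\<Sum>i\<in>insert k W. c i * x i) = 0}"
  have H: "?H \<in> sets ?M"
    by measurable
  have slice: "(\<integral>\<^sup>+ y. indicator ?H (x(k := y)) \<partial>lborel) = 0" if "x \<in> space (\<Pi>\<^sub>M i\<in>W. (lborel :: real measure))" for x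
  proof -
    let ?y = "- (\<Sum>i\<in>W. c i * x i) / c k"
    have "(\<Sum>i\<in>insert k W. c i * (x(k := y)) i) = c k * y + (\<Sum>i\<in>W. c i * x i)" for y
      using W by (auto intro!: sum.cong)
    then have "y = ?y" if "x(k := y) \<in> ?H" for y
      using that assms(3) by (auto simp: field_simps eq_neg_iff_add_eq_0)
    then have "(\<integral>\<^sup>+ y. indicator ?H (x(k := y)) \<partial>lborel) \<le> (\<integral>\<^sup>+ y. indicator {?y} y \<partial>lborel)"
      by (intro nn_integral_mono) (auto simp: indicator_def)
    then show ?thesis by simp
  qed
  have "emeasure ?M ?H = (\<integral>\<^sup>+ x. indicator ?H x \<partial>?M)"
    using H by simp
  also have "\<dots> = (\<integral>\<^sup>+ x. (\<integral>\<^sup>+ y. indicator ?H (x(k := y)) \<partial>lborel) \<partial>(\<Pi>\<^sub>M i\<in>W. lborel))"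
    by (rule product_nn_integral_insert) (use W H in auto)
  also have "\<dots> = 0"
    using slice by (simp cong: nn_integral_cong)
  finally have "?H \<in> null_sets ?M"
    using H by auto
  then show ?thesis
    unfolding V by (rule AE_I') auto
qed

section \<open>Averaging steps are invertible\<close>

text \<open>
  One step of the dynamics with the neighbourhoods \<open>N\<close> prescribed rather than read off from \<open>x\<close>:
  for fixed \<open>N\<close> it is linear in \<open>x\<close>.
\<close>

definition averaging_step ::
  "real \<Rightarrow> (nat \<Rightarrow> nat set) \<Rightarrow> (nat \<Rightarrow> real) \<Rightarrow> nat \<Rightarrow> real" where
  "averaging_step \<alpha> N x i =
    (if N i \<noteq> {} then x i + \<alpha> / real (card (N i)) * (\<Sum>j\<in>N i. x j - x i) else x i)"

lemma opinion_Suc: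
  "opinion V E \<alpha> R \<rho> x0 (Suc t) =
    averaging_step \<alpha> (nbrs V E (R * \<rho> ^ t) (opinion V E \<alpha> R \<rho> x0 t)) (opinion V E \<alpha> R \<rho> x0 t)"
  by (simp add: averaging_step_def Let_def fun_eq_iff)

text \<open>
  The matrix \<open>P\<close> of the step has diagonal part \<open>a\<close>, which is \<open>1 - \<alpha>\<close> or \<open>1\<close>, and a nonnegative
  remaining part \<open>b\<close>, whose \<open>i\<close>-th row sums to \<open>1 - a i\<close>.  If \<open>c P = 0\<close>, then \<open>a j * \<bar>c j\<bar>\<close> is at most
  the sum over \<open>i\<close> of \<open>\<bar>c i\<bar> * b i j\<close>.  Summation over \<open>j\<close> bounds the sum of \<open>\<bar>c i\<bar> * (2 * a i - 1)\<close> by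
  zero, which forces \<open>c = 0\<close>, because \<open>\<alpha> < 1 / 2\<close> makes \<open>2 * a i - 1\<close> positive.
\<close>

lemma averaging_step_pullback:
  assumes V: "finite V" "\<And>i. i \<in> V \<Longrightarrow> N i \<subseteq> V"
    and \<alpha>: "0 < \<alpha>" "\<alpha> < 1 / 2"
    and c: "\<exists>k\<in>V. c k \<noteq> 0"
  obtains c' where "\<exists>k\<in>V. c' k \<noteq> 0"
    "\<And>x. (\<Sum>i\<in>V. c i * averaging_step \<alpha> N x i) = (\<Sum>i\<in>V. c' i * x i)"
proof -
  define a where "a i = (if N i \<noteq> {} then 1 - \<alpha> else 1)" for i
  define b where "b i j = (if j \<in> N i then \<alpha> / real (card (N i)) else 0)" for i j
  define c' where "c' j = a j * c j + (\<Sum>i\<in>V. c i * b i j)" for j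
  have fin: "finite (N i)" if "i \<in> V" for i
    using V that finite_subset by blast
  have b_sum: "(\<Sum>j\<in>V. b i j * x j) = \<alpha> / real (card (N i)) * (\<Sum>j\<in>N i. x j)" if "i \<in> V" for i x
  proof -
    have "(\<Sum>j\<in>V. b i j * x j) = (\<Sum>j\<in>N i. b i j * x j)"
      using V that by (intro sum.mono_neutral_right) (auto simp: b_def)
    then show ?thesis
      by (simp add: b_def sum_distrib_left)
  qed
  have b_row: "(\<Sum>j\<in>V. b i j) = 1 - a i" if "i \<in> V" for i
    using b_sum[OF that, of "\<lambda>_. 1"] fin[OF that] by (auto simp: a_def)
  have b_nonneg: "b i j \<ge> 0" for i j
    using \<alpha> by (simp add: b_def)
  have step: "averaging_step \<alpha> N x i = a i * x i + (\<Sum>j\<in>V. b i j * x j)" if "i \<in> V" for x i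
  proof (cases "N i = {}")
    case False
    then have "real (card (N i)) > 0"
      using fin[OF that] by (simp add: card_gt_0_iff)
    then show ?thesis
      using False unfolding averaging_step_def b_sum[OF that] a_def
      by (simp add: sum_subtractf right_diff_distrib left_diff_distrib)
  next
    case True
    then show ?thesis
      unfolding averaging_step_def b_sum[OF that] a_def by simp
  qed
  have "(\<Sum>i\<in>V. c i * averaging_step \<alpha> N x i) = (\<Sum>i\<in>V. c' i * x i)" for x
  proof -
    have "(\<Sum>i\<in>V. c i * averaging_step \<alpha> N x i)
        = (\<Sum>i\<in>V. a i * c i * x i) + (\<Sum>i\<in>V. \<Sum>j\<in>V. c i * b i j * x j)"
      unfolding sum.distrib[symmetric]
      by (intro sum.cong) (simp_all add: step distrib_left sum_distrib_left mult.assoc mult.left_commute)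
    also have "(\<Sum>i\<in>V. \<Sum>j\<in>V. c i * b i j * x j) = (\<Sum>j\<in>V. \<Sum>i\<in>V. c i * b i j * x j)"
      by (rule sum.swap)
    finally show ?thesis
      by (simp only: c'_def distrib_right sum.distrib sum_distrib_right)
  qed
  moreover have "\<exists>k\<in>V. c' k \<noteq> 0"
  proof (rule ccontr)
    assume "\<not> (\<exists>k\<in>V. c' k \<noteq> 0)"
    then have zero: "a j * c j = - (\<Sum>i\<in>V. c i * b i j)" if "j \<in> V" for j
      using that by (auto simp: c'_def)
    have "a j * \<bar>c j\<bar> \<le> (\<Sum>i\<in>V. \<bar>c i\<bar> * b i j)" if "j \<in> V" for j
    proof -
      have "a j * \<bar>c j\<bar> = \<bar>a j * c j\<bar>"
        using \<alpha> by (simp add: abs_mult a_def)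
      also have "\<dots> \<le> (\<Sum>i\<in>V. \<bar>c i * b i j\<bar>)"
        by (simp add: zero[OF that] sum_abs)
      finally show ?thesis
        using b_nonneg by (simp add: abs_mult)
    qed
    then have "(\<Sum>j\<in>V. a j * \<bar>c j\<bar>) \<le> (\<Sum>j\<in>V. \<Sum>i\<in>V. \<bar>c i\<bar> * b i j)"
      by (rule sum_mono)
    also have "\<dots> = (\<Sum>i\<in>V. \<Sum>j\<in>V. \<bar>c i\<bar> * b i j)"
      by (rule sum.swap)
    also have "\<dots> = (\<Sum>i\<in>V. \<bar>c i\<bar> * (1 - a i))"
      by (simp add: b_row flip: sum_distrib_left)
    finally have "(\<Sum>j\<in>V. a j * \<bar>c j\<bar>) - (\<Sum>i\<in>V. \<bar>c i\<bar> * (1 - a i)) \<le> 0"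
      by simp
    also have "(\<Sum>j\<in>V. a j * \<bar>c j\<bar>) - (\<Sum>i\<in>V. \<bar>c i\<bar> * (1 - a i)) = (\<Sum>i\<in>V. \<bar>c i\<bar> * (2 * a i - 1))"
      unfolding sum_subtractf[symmetric] by (intro sum.cong) (auto simp: algebra_simps)
    finally have "(\<Sum>i\<in>V. \<bar>c i\<bar> * (2 * a i - 1)) \<le> 0" .
    moreover have "0 < (\<Sum>i\<in>V. \<bar>c i\<bar> * (2 * a i - 1))"
      using c V \<alpha> by (auto intro!: sum_pos2 simp: a_def)
    ultimately show False by simp
  qed
  ultimately show ?thesis using that by blast
qed

text \<open>
  The last step of the trajectory applies one of finitely many averaging maps.  The functional
  pulls back along each of them to a nonzero functional of the opinions one step earlier, to which
  the induction hypothesis applies.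
\<close>

lemma AE_opinion_avoids_hyperplane:
  assumes V: "finite V" and \<alpha>: "0 < \<alpha>" "\<alpha> < 1 / 2"
    and c: "\<exists>k\<in>V. c k \<noteq> 0"
  shows "AE x0 in (\<Pi>\<^sub>M i\<in>V. lborel). (\<Sum>i\<in>V. c i * opinion V E \<alpha> R \<rho> x0 t i) \<noteq> 0"
  using c
proof (induction t arbitrary: c)
  case 0
  then show ?case
    using AE_linear_functional_nonzero[OF V] by auto
next
  case (Suc t)
  \<comment> \<open>Values outside \<open>V\<close> are normalized, so that there are only finitely many neighbourhood maps.\<close>
  define \<N> where "\<N> = (V \<rightarrow>\<^sub>E Pow V)"
  have "AE x0 in (\<Pi>\<^sub>M i\<in>V. lborel).
      (\<Sum>i\<in>V. c i * averaging_step \<alpha> N (opinion V E \<alpha> R \<rho> x0 t) i) \<noteq> 0" if "N \<in> \<N>" for N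
  proof -
    have "\<And>i. i \<in> V \<Longrightarrow> N i \<subseteq> V"
      using that by (auto simp: \<N>_def)
    then obtain c' where
      c': "\<exists>k\<in>V. c' k \<noteq> 0"
      "\<And>x. (\<Sum>i\<in>V. c i * averaging_step \<alpha> N x i) = (\<Sum>i\<in>V. c' i * x i)"
      using averaging_step_pullback[OF V _ \<alpha> Suc.prems, of N] by blast
    show ?thesis
      unfolding c'(2) by (rule Suc.IH[OF c'(1)])
  qed
  moreover have "finite \<N>"
    unfolding \<N>_def using V by (intro finite_PiE) auto
  ultimately have "AE x0 in (\<Pi>\<^sub>M i\<in>V. lborel). \<forall>N\<in>\<N>.
      (\<Sum>i\<in>V. c i * averaging_step \<alpha> N (opinion V E \<alpha> R \<rho> x0 t) i) \<noteq> 0"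
    by (intro AE_finite_allI) auto
  then show ?case
  proof (rule AE_mp, intro AE_I2 impI)
    fix x0
    let ?x = "opinion V E \<alpha> R \<rho> x0 t"
    let ?N = "nbrs V E (R * \<rho> ^ t) ?x"
    assume *: "\<forall>N\<in>\<N>. (\<Sum>i\<in>V. c i * averaging_step \<alpha> N ?x i) \<noteq> 0"
    have "restrict ?N V \<in> \<N>"
      by (auto simp: \<N>_def nbrs_def)
    then have "(\<Sum>i\<in>V. c i * averaging_step \<alpha> (restrict ?N V) ?x i) \<noteq> 0"
      using * by blast
    moreover have "averaging_step \<alpha> (restrict ?N V) ?x i = opinion V E \<alpha> R \<rho> x0 (Suc t) i"
      if "i \<in> V" for i
      using that unfolding opinion_Suc by (simp add: averaging_step_def)
    ultimately show "(\<Sum>i\<in>V. c i * opinion V E \<alpha> R \<rho> x0 (Suc t) i) \<noteq> 0"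
      by (simp cong: sum.cong del: opinion.simps)
  qed
qed

section \<open>The second eigenvalue of a real symmetric matrix\<close>

text \<open>
  Over the complex numbers the characteristic polynomial splits, and its roots are real because
  \<open>cnj v \<bullet> A v\<close> is real for symmetric \<open>A\<close>.  In particular \<open>\<mu>\<^sub>2\<close> of a symmetric matrix of
  dimension at least 2 refers to an actual list position.
\<close>

lemma symmetric_char_poly_splits:
  fixes A :: "real mat"
  assumes A: "A \<in> carrier_mat n n" and sym: "transpose_mat A = A"
  obtains es where "char_poly A = (\<Prod>e\<leftarrow>es. [:- e, 1:])" "length es = n"
proof -
  let ?C = "map_mat complex_of_real A"
  have C: "?C \<in> carrier_mat n n"
    using A by simp
  obtain zs where zs: "char_poly ?C = (\<Prod>z\<leftarrow>zs. [:- z, 1:])" "length zs = n"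
    using char_poly_factorized[OF C] by blast
  have A_sym: "A $$ (i, j) = A $$ (j, i)" if "i < n" "j < n" for i j
    using sym A that by (metis index_transpose_mat(1) carrier_matD)
  have real: "Im z = 0" if "z \<in> set zs" for z
  proof -
    have "poly (char_poly ?C) z = 0"
      using that unfolding zs(1) by (auto simp: poly_prod_list prod_list_zero_iff)
    then obtain v where "eigenvector ?C v z"
      using eigenvalue_root_char_poly[OF C] unfolding eigenvalue_def by blast
    then have v: "v \<in> carrier_vec n" "v \<noteq> 0\<^sub>v n" and Cv: "?C *\<^sub>v v = z \<cdot>\<^sub>v v"
      using C by (auto simp: eigenvector_def)
    have row: "(\<Sum>j<n. A $$ (i, j) * v $ j) = z * v $ i" if "i < n" for i
      using arg_cong[OF Cv, of "\<lambda>w. w $ i"] that v A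
      by (auto simp: scalar_prod_def lessThan_atLeast0)
    define q where "q = (\<Sum>i<n. \<Sum>j<n. A $$ (i, j) * (cnj (v $ i) * v $ j))"
    define s where "s = (\<Sum>i<n. (cmod (v $ i))\<^sup>2)"
    have "cnj q = (\<Sum>i<n. \<Sum>j<n. A $$ (j, i) * (cnj (v $ j) * v $ i))"
      by (auto simp: q_def A_sym intro!: sum.cong)
    also have "\<dots> = q"
      unfolding q_def by (rule sum.swap)
    finally have "Im q = 0"
      by (metis cnj.simps(2) neg_equal_zero)
    have "q = (\<Sum>i<n. cnj (v $ i) * (\<Sum>j<n. A $$ (i, j) * v $ j))"
      by (simp add: q_def sum_distrib_left mult_ac)
    also have "\<dots> = (\<Sum>i<n. z * (v $ i * cnj (v $ i)))"
      by (intro sum.cong) (auto simp: row)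
    also have "\<dots> = z * s"
      by (simp add: s_def sum_distrib_left flip: complex_norm_square)
    finally have "q = z * of_real s" .
    moreover have "s > 0"
    proof -
      obtain i where "i < n" "v $ i \<noteq> 0"
        using v by (metis carrier_vecD eq_vecI index_zero_vec)
      then show ?thesis
        unfolding s_def by (intro sum_pos2[of _ i]) auto
    qed
    ultimately show ?thesis
      using \<open>Im q = 0\<close> by simp
  qed
  let ?es = "map Re zs"
  have zs_real: "zs = map complex_of_real ?es"
    using real by (auto simp: complex_eq_iff intro!: nth_equalityI)
  interpret of_real_poly_hom: map_poly_inj_comm_ring_hom complex_of_real ..
  have "map_poly complex_of_real (char_poly A) = char_poly ?C"
    by (rule of_real_hom.char_poly_hom[OF A, symmetric])
  also have "\<dots> = (\<Prod>e\<leftarrow>?es. [:- complex_of_real e, 1:])"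
    unfolding zs(1) by (subst zs_real) (simp add: o_def)
  also have "\<dots> = map_poly complex_of_real (\<Prod>e\<leftarrow>?es. [:- e, 1:])"
    by (simp add: of_real_poly_hom.hom_prod_list o_def)
  finally have "char_poly A = (\<Prod>e\<leftarrow>?es. [:- e, 1:])"
    by simp
  then show ?thesis
    by (rule that) (simp add: zs(2))
qed

lemma proots_prod_linear_factors: "proots (\<Prod>e\<leftarrow>es. [:- e, 1:]) = mset (es :: 'a :: idom list)"
proof (induction es)
  case (Cons e es)
  have "(\<Prod>e\<leftarrow>es. [:- e, 1:]) \<noteq> 0"
    by (auto simp: prod_list_zero_iff)
  then show ?case
    using Cons by (simp add: proots_mult del: mult_pCons_left)
qed simp

text \<open>
  Of the two smallest eigenvalues, one that is nonzero has an eigenvector, which is orthogonal to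
  the null vector \<open>u\<close> by self-adjointness.  If both are zero, the kernel has to be shown to be at
  least two-dimensional, so that it contains a nonzero vector orthogonal to \<open>u\<close>.  A Schur
  decomposition that lists these two eigenvalues first gives independent vectors \<open>p\<close>, \<open>q\<close> with
  \<open>A p = 0\<close> and \<open>A q = \<beta> p\<close>; then \<open>\<beta> * (p \<bullet> p) = p \<bullet> A q = A p \<bullet> q = 0\<close>, so \<open>A q = 0\<close>.
\<close>

lemma symmetric_second_eigenvector:
  fixes A :: "real mat"
  assumes A: "A \<in> carrier_mat n n" and n: "2 \<le> n" and sym: "transpose_mat A = A"
    and u: "u \<in> carrier_vec n" "A *\<^sub>v u = 0\<^sub>v n"
  obtains \<mu> v where "\<mu> \<le> \<mu>\<^sub>2 A" "v \<in> carrier_vec n" "v \<noteq> 0\<^sub>v n" "A *\<^sub>v v = \<mu> \<cdot>\<^sub>v v" "v \<bullet> u = 0"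
proof -
  obtain es' where es': "char_poly A = (\<Prod>e\<leftarrow>es'. [:- e, 1:])" "length es' = n"
    using symmetric_char_poly_splits[OF A sym] by blast
  define es where "es = sort es'"
  have "mset es = mset es'" by (simp add: es_def)
  then have "mset (map (\<lambda>e. [:- e, 1:]) es) = mset (map (\<lambda>e. [:- e, 1:]) es')"
    by simp
  then have es: "char_poly A = (\<Prod>e\<leftarrow>es. [:- e, 1:])"
    unfolding es'(1) by (metis prod_mset_prod_list)
  have len: "length es = n" "sorted es"
    by (auto simp: es_def es'(2))
  have "proots (char_poly A) = mset es"
    unfolding es by (rule proots_prod_linear_factors)
  then have \<mu>2: "\<mu>\<^sub>2 A = es ! 1"
    by (simp add: \<mu>\<^sub>2_def len sorted_sort_id)
  have le: "es ! 0 \<le> es ! 1"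
    using len n by (intro sorted_nth_mono) auto
  have self_adjoint: "(A *\<^sub>v v) \<bullet> w = v \<bullet> (A *\<^sub>v w)" if "v \<in> carrier_vec n" "w \<in> carrier_vec n" for v w
    using transpose_vec_mult_scalar[OF A that(2,1)] by (simp add: sym)
  note found = that
  have nonzero_case: thesis if \<mu>: "\<mu> \<in> set es" "\<mu> \<noteq> 0" "\<mu> \<le> \<mu>\<^sub>2 A" for \<mu>
  proof -
    have "poly (char_poly A) \<mu> = 0"
      using \<mu> unfolding es by (auto simp: poly_prod_list prod_list_zero_iff)
    then obtain v where "eigenvector A v \<mu>"
      using eigenvalue_root_char_poly[OF A] unfolding eigenvalue_def by blast
    then have v: "v \<in> carrier_vec n" "v \<noteq> 0\<^sub>v n" "A *\<^sub>v v = \<mu> \<cdot>\<^sub>v v"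
      using A by (auto simp: eigenvector_def)
    have "\<mu> * (v \<bullet> u) = (A *\<^sub>v v) \<bullet> u"
      using v u by simp
    also have "\<dots> = 0"
      using self_adjoint[OF v(1) u(1)] u v by simp
    finally show thesis
      using found[OF \<mu>(3) v] \<mu>(2) by simp
  qed
  show thesis
  proof (cases "es ! 0 = 0 \<and> es ! 1 = 0")
    case False
    have "es ! 0 \<in> set es" "es ! 1 \<in> set es"
      using len n by auto
    then show thesis
      using False nonzero_case le \<mu>2 by (metis order_refl)
  next
    case True
    obtain B P Q where BPQ: "schur_decomposition A es = (B, P, Q)"
      by (cases "schur_decomposition A es")
    from schur_decomposition[OF A es BPQ]
    have wit: "similar_mat_wit A B P Q" and B: "upper_triangular B" "diag_mat B = es"
      by auto
    from similar_mat_witD2[OF A wit]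
    have carr: "B \<in> carrier_mat n n" "P \<in> carrier_mat n n" "Q \<in> carrier_mat n n"
      and QP: "P * Q = 1\<^sub>m n" "Q * P = 1\<^sub>m n" and AP: "A = P * B * Q"
      by auto
    have "A * P = P * B * (Q * P)"
      unfolding AP using carr by (simp add: assoc_mult_mat[of _ n n _ n _ n])
    then have AP: "A * P = P * B"
      using carr QP by simp
    have diag: "B $$ (0, 0) = 0" "B $$ (1, 1) = 0"
      using True carr n by (auto simp flip: B(2) simp: diag_mat_def)
    define p where "p = col P 0"
    define q where "q = col P 1"
    define \<beta> where "\<beta> = B $$ (0, 1)"
    have pq: "p \<in> carrier_vec n" "q \<in> carrier_vec n"
      using carr by (auto simp: p_def q_def)
    have "col B 0 = 0\<^sub>v n"
      using diag(1) B(1) carr n by (auto simp: upper_triangular_def intro!: eq_vecI) (metis gr0I)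
    have "col B 1 = \<beta> \<cdot>\<^sub>v unit_vec n 0"
    proof (rule eq_vecI)
      fix i assume "i < dim_vec (\<beta> \<cdot>\<^sub>v unit_vec n 0)"
      then have "i < n" by simp
      consider "i = 0" | "i = 1" | "1 < i" by linarith
      then show "col B 1 $ i = (\<beta> \<cdot>\<^sub>v unit_vec n 0) $ i"
        using \<open>i < n\<close> n carr diag(2) B(1)
        by cases (auto simp: \<beta>_def upper_triangular_def)
    qed (use carr in auto)
    have zero: "C *\<^sub>v 0\<^sub>v n = 0\<^sub>v n" if "C \<in> carrier_mat n n" for C :: "real mat"
      using that by (intro eq_vecI) auto
    have zero_smult: "0 \<cdot>\<^sub>v w = 0\<^sub>v n" if "w \<in> carrier_vec n" for w :: "real vec"
      using that by (intro eq_vecI) auto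
    have "A *\<^sub>v p = P *\<^sub>v col B 0" "A *\<^sub>v q = P *\<^sub>v col B 1"
      using carr n A AP by (auto simp: p_def q_def simp flip: col_mult2[of _ n n _ n])
    moreover have "P *\<^sub>v (\<beta> \<cdot>\<^sub>v unit_vec n 0) = \<beta> \<cdot>\<^sub>v p"
      using carr n by (intro eq_vecI) (auto simp: p_def)
    ultimately have Ap: "A *\<^sub>v p = 0\<^sub>v n" and Aq: "A *\<^sub>v q = \<beta> \<cdot>\<^sub>v p"
      using \<open>col B 0 = 0\<^sub>v n\<close> \<open>col B 1 = \<beta> \<cdot>\<^sub>v unit_vec n 0\<close> carr zero by auto
    have Qp: "Q *\<^sub>v p = unit_vec n 0" and Qq: "Q *\<^sub>v q = unit_vec n 1"
      using carr n QP(2) by (auto simp: p_def q_def simp flip: col_mult2[of _ n n _ n])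
    have "p \<noteq> 0\<^sub>v n"
    proof
      assume "p = 0\<^sub>v n"
      then have "unit_vec n 0 = (0\<^sub>v n :: real vec)"
        using Qp carr zero by simp
      then show False
        using n by (metis index_unit_vec(1) index_zero_vec(1) less_le_trans pos2 zero_neq_one)
    qed
    then have "p \<bullet> p \<noteq> 0"
      using pq(1) conjugate_square_eq_0_vec[OF pq(1)] by simp
    moreover have "\<beta> * (p \<bullet> p) = 0"
    proof -
      have "\<beta> * (p \<bullet> p) = p \<bullet> (A *\<^sub>v q)"
        using pq by (simp add: Aq)
      also have "\<dots> = 0"
        using self_adjoint[OF pq] Ap pq by simp
      finally show ?thesis .
    qed
    ultimately have Aq: "A *\<^sub>v q = 0\<^sub>v n"
      using Aq pq by auto
    show thesis
    proof (cases "p \<bullet> u = 0")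
      case True
      show thesis
        using found[of 0 p] \<open>p \<noteq> 0\<^sub>v n\<close> pq Ap True \<open>es ! 0 = 0 \<and> es ! 1 = 0\<close> \<mu>2 zero_smult by auto
    next
      case False
      \<comment> \<open>The combination of \<open>p\<close> and \<open>q\<close> whose scalar product with \<open>u\<close> cancels.\<close>
      define v where "v = (q \<bullet> u) \<cdot>\<^sub>v p - (p \<bullet> u) \<cdot>\<^sub>v q"
      have v: "v \<in> carrier_vec n"
        using pq by (simp add: v_def)
      have "A *\<^sub>v v = (q \<bullet> u) \<cdot>\<^sub>v 0\<^sub>v n - (p \<bullet> u) \<cdot>\<^sub>v 0\<^sub>v n"
        using pq A by (simp add: v_def mult_minus_distrib_mat_vec[of _ n n] mult_mat_vec[of _ n n] Ap Aq)
      also have "\<dots> = 0\<^sub>v n"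
        by (intro eq_vecI) auto
      finally have "A *\<^sub>v v = 0\<^sub>v n" .
      moreover have "v \<bullet> u = 0"
        using pq u by (simp add: v_def minus_scalar_prod_distrib[of _ n])
      moreover have "v \<noteq> 0\<^sub>v n"
      proof
        assume "v = 0\<^sub>v n"
        then have "Q *\<^sub>v v = 0\<^sub>v n"
          using carr zero by simp
        moreover have "Q *\<^sub>v v = (q \<bullet> u) \<cdot>\<^sub>v unit_vec n 0 - (p \<bullet> u) \<cdot>\<^sub>v unit_vec n 1"
          using pq carr by (simp add: v_def mult_minus_distrib_mat_vec[of _ n n] mult_mat_vec[of _ n n] Qp Qq)
        ultimately have "((q \<bullet> u) \<cdot>\<^sub>v unit_vec n 0 - (p \<bullet> u) \<cdot>\<^sub>v unit_vec n 1) $ 1 = (0\<^sub>v n :: real vec) $ 1"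
          by simp
        then show False
          using n False by simp
      qed
      ultimately show thesis
        using found[of 0 v] v \<open>es ! 0 = 0 \<and> es ! 1 = 0\<close> \<mu>2 zero_smult by auto
    qed
  qed
qed

section \<open>Linear functionals from eigenvectors of the normalized Laplacian\<close>

lemma laplacian_entry_commute:
  assumes "sym F"
  shows "laplacian_entry W F i j = laplacian_entry W F j i"
  using assms by (auto simp: laplacian_entry_def mult.commute dest: symD)

text \<open>
  With \<open>S\<close> the diagonal matrix of the weights \<open>s\<close>, the identity reads \<open>L S = S L'\<close>, where \<open>L'\<close> is
  the random walk Laplacian, which compares \<open>x i\<close> with the mean over the neighbours of \<open>i\<close>.  The weight
  of an isolated vertex is arbitrary but must be nonzero for \<open>S\<close> to be invertible; hence the value 1.
\<close>

lemma laplacian_entry_weighted_sum: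
  fixes W F
  defines "N \<equiv> \<lambda>i. {j \<in> W. (i, j) \<in> F}"
  defines "s \<equiv> \<lambda>i. if N i = {} then 1 else sqrt (real (card (N i)))"
  assumes W: "finite W" and F: "sym F" "irrefl F" and i: "i \<in> W"
  shows "(\<Sum>j\<in>W. laplacian_entry W F i j * (s j * x j)) =
    s i * (if N i = {} then 0 else x i - (\<Sum>j\<in>N i. x j) / real (card (N i)))"
proof (cases "N i = {}")
  case True
  have "vertex_degree W F i = card (N i)"
    by (simp add: vertex_degree_def N_def)
  then have "laplacian_entry W F i j = 0" if "j \<in> W" for j
    using True by (simp add: laplacian_entry_def)
  then show ?thesis
    using True by simp
next
  case False
  have fin: "finite (N j)" for j
    using W by (simp add: N_def)
  have card: "real (card (N i)) > 0"
    using False fin by (simp add: card_gt_0_iff)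
  have s_pos: "s j > 0" for j
    using fin[of j] by (simp add: s_def card_gt_0_iff)
  have entry: "laplacian_entry W F i j * (s j * x j) =
      (if i = j then s i * x i else 0) + (if j \<in> N i then - (1 / s i) * x j else 0)" if "j \<in> W" for j
  proof -
    consider "i = j" | "i \<noteq> j" "j \<in> N i" | "i \<noteq> j" "j \<notin> N i" by blast
    then show ?thesis
    proof cases
      case 1
      then show ?thesis
        using F(2) card by (simp add: laplacian_entry_def vertex_degree_def irrefl_def N_def)
    next
      case 2
      then have "i \<in> N j"
        using F(1) i by (auto simp: N_def dest: symD)
      then have "sqrt (real (card (N i)) * real (card (N j))) = s i * s j"
        using False by (auto simp: s_def real_sqrt_mult)
      then have "laplacian_entry W F i j = - 1 / (s i * s j)"
        using 2 by (simp add: laplacian_entry_def vertex_degree_def N_def)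
      then show ?thesis
        using 2 s_pos[of i] s_pos[of j] by simp
    next
      case 3
      then show ?thesis
        using that by (simp add: laplacian_entry_def N_def)
    qed
  qed
  have "(\<Sum>j\<in>W. laplacian_entry W F i j * (s j * x j))
      = (\<Sum>j\<in>W. if i = j then s i * x i else 0) + (\<Sum>j\<in>W. if j \<in> N i then - (1 / s i) * x j else 0)"
    unfolding sum.distrib[symmetric] by (intro sum.cong) (simp_all only: entry)
  also have "(\<Sum>j\<in>W. if j \<in> N i then - (1 / s i) * x j else 0) = (\<Sum>j\<in>N i. - (1 / s i) * x j)"
    using W by (simp only: sum.inter_filter[symmetric]) (auto simp: N_def intro!: sum.cong)
  also have "\<dots> = - (1 / s i) * (\<Sum>j\<in>N i. x j)"
    by (simp only: sum_distrib_left)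
  also have "(\<Sum>j\<in>W. if i = j then s i * x i else 0) = s i * x i"
    using W i by simp
  also have "1 / s i = s i / real (card (N i))"
    using False card s_pos[of i] by (simp add: s_def real_div_sqrt field_simps)
  finally show ?thesis
    using False by (simp add: right_diff_distrib)
qed

lemma averaging_step_eq_diff:
  assumes "finite (N i)"
  shows "averaging_step \<alpha> N x i =
    x i - \<alpha> * (if N i = {} then 0 else x i - (\<Sum>j\<in>N i. x j) / real (card (N i)))"
proof (cases "N i = {}")
  case False
  then have "real (card (N i)) > 0"
    using assms by (simp add: card_gt_0_iff)
  then show ?thesis
    using False unfolding averaging_step_def
    by (simp add: sum_subtractf right_diff_distrib)
qed (simp add: averaging_step_def)

text \<open>
  If \<open>v\<close> is an eigenvector of \<open>L\<close> for \<open>\<mu>\<close>, then the row vector \<open>c = v S\<close> satisfies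
  \<open>c L' = v S L' = v L S = \<mu> c\<close>, so \<open>c\<close> is multiplied by \<open>1 - \<alpha> * \<mu>\<close> under the step \<open>1 - \<alpha> L'\<close>.
  Since \<open>L'\<close> kills constants, \<open>u = S 1\<close> is a null vector of \<open>L\<close>, and choosing \<open>v\<close> orthogonal to
  \<open>u\<close> means that the entries of \<open>c\<close> sum to zero.
\<close>

lemma laplacian_eigenfunctional:
  assumes W: "finite W" "2 \<le> card W" and F: "sym F" "irrefl F"
  obtains \<mu> c where "\<mu> \<le> \<mu>\<^sub>2 (normalized_laplacian W F)" "\<exists>i\<in>W. c i \<noteq> 0" "(\<Sum>i\<in>W. c i) = 0"
    "\<And>\<alpha> x. (\<Sum>i\<in>W. c i * averaging_step \<alpha> (\<lambda>i. {j \<in> W. (i, j) \<in> F}) x i) =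
      (1 - \<alpha> * \<mu>) * (\<Sum>i\<in>W. c i * x i)"
proof -
  define n where "n = card W"
  define e where "e = (!) (sorted_list_of_set W)"
  define l where "l = laplacian_entry W F"
  define N where "N = (\<lambda>i. {j \<in> W. (i, j) \<in> F})"
  define s where "s = (\<lambda>i. if N i = {} then 1 else sqrt (real (card (N i))))"
  define r where "r x i = (if N i = {} then 0 else x i - (\<Sum>j\<in>N i. x j) / real (card (N i)))"
    for x :: "nat \<Rightarrow> real" and i
  have fin: "finite (N i)" for i
    using W by (simp add: N_def)
  have s_pos: "s j > 0" for j
    using fin[of j] by (simp add: s_def card_gt_0_iff)
  have ls: "(\<Sum>j\<in>W. l i j * (s j * x j)) = s i * r x i" if "i \<in> W" for i x
    unfolding l_def s_def r_def N_def
    by (rule laplacian_entry_weighted_sum[OF W(1) F that])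
  have e: "bij_betw e {..<n} W"
    unfolding e_def n_def using W by (intro bij_betw_nth) auto
  have reindex: "(\<Sum>a<n. f (e a)) = (\<Sum>i\<in>W. f i)" for f :: "nat \<Rightarrow> real"
    by (rule sum.reindex_bij_betw[OF e])
  have e_in: "e a \<in> W" if "a < n" for a
    using e that by (auto simp: bij_betw_def)
  let ?A = "normalized_laplacian W F"
  have A: "?A \<in> carrier_mat n n"
    by (simp add: normalized_laplacian_def n_def)
  have entry: "?A $$ (a, b) = l (e a) (e b)" if "a < n" "b < n" for a b
    using that by (simp add: normalized_laplacian_def n_def e_def l_def)
  have sym: "transpose_mat ?A = ?A"
    using A by (intro eq_matI) (auto simp: entry l_def laplacian_entry_commute[OF F(1)])
  define u where "u = vec n (\<lambda>a. s (e a))"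
  have "?A *\<^sub>v u = 0\<^sub>v n"
  proof (rule eq_vecI)
    fix a assume "a < dim_vec (0\<^sub>v n :: real vec)"
    then have a: "a < n" by simp
    then have "(?A *\<^sub>v u) $ a = (\<Sum>b<n. l (e a) (e b) * (s (e b) * 1))"
      using A by (auto simp: u_def scalar_prod_def entry lessThan_atLeast0 intro!: sum.cong)
    also have "\<dots> = s (e a) * r (\<lambda>_. 1) (e a)"
      using reindex[of "\<lambda>j. l (e a) j * (s j * 1)"] ls[OF e_in[OF a], of "\<lambda>_. 1"] by simp
    also have "r (\<lambda>_. 1) (e a) = 0"
      using fin by (simp add: r_def)
    finally show "(?A *\<^sub>v u) $ a = 0\<^sub>v n $ a"
      using a by simp
  qed (use A in auto)
  then obtain \<mu> v where \<mu>: "\<mu> \<le> \<mu>\<^sub>2 ?A" and v: "v \<in> carrier_vec n" "v \<noteq> 0\<^sub>v n"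
    and Av: "?A *\<^sub>v v = \<mu> \<cdot>\<^sub>v v" and vu: "v \<bullet> u = 0"
    using symmetric_second_eigenvector[OF A _ sym, of u] W(2) by (auto simp: n_def u_def)
  \<comment> \<open>The eigenvector \<open>v\<close>, indexed by vertices instead of matrix positions.\<close>
  define w where "w i = v $ the_inv_into {..<n} e i" for i
  have w: "w (e a) = v $ a" if "a < n" for a
    using e that by (simp add: w_def bij_betw_def the_inv_into_f_f)
  have eigen: "(\<Sum>i\<in>W. l j i * w i) = \<mu> * w j" if "j \<in> W" for j
  proof -
    obtain a where a: "a < n" "j = e a"
      using e \<open>j \<in> W\<close> by (auto simp: bij_betw_def)
    have "(\<Sum>i\<in>W. l j i * w i) = (\<Sum>b<n. l j (e b) * w (e b))"
      by (rule reindex[symmetric])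
    also have "\<dots> = (?A *\<^sub>v v) $ a"
      using A v a by (auto simp: scalar_prod_def entry w lessThan_atLeast0 intro!: sum.cong)
    finally show ?thesis
      using a v by (simp add: Av w)
  qed
  define c where "c i = w i * s i" for i
  have "\<exists>i\<in>W. c i \<noteq> 0"
  proof -
    obtain a where a: "a < n" "v $ a \<noteq> 0"
      using v by (metis carrier_vecD eq_vecI index_zero_vec)
    then show ?thesis
      using s_pos[of "e a"] e_in by (intro bexI[of _ "e a"]) (auto simp: c_def w)
  qed
  moreover have "(\<Sum>i\<in>W. c i) = 0"
  proof -
    have "(\<Sum>i\<in>W. c i) = (\<Sum>a<n. c (e a))"
      by (rule reindex[symmetric])
    also have "\<dots> = v \<bullet> u"
      by (auto simp: u_def scalar_prod_def c_def w lessThan_atLeast0 intro!: sum.cong)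
    finally show ?thesis
      using vu by simp
  qed
  moreover have "(\<Sum>i\<in>W. c i * averaging_step \<alpha> N x i) = (1 - \<alpha> * \<mu>) * (\<Sum>i\<in>W. c i * x i)" for \<alpha> x
  proof -
    have row: "w i * (\<Sum>j\<in>W. l i j * (s j * x j)) = (\<Sum>j\<in>W. l j i * w i * (s j * x j))" for i
      unfolding sum_distrib_left using laplacian_entry_commute[OF F(1), of W i]
      by (intro sum.cong) (simp_all add: l_def)
    have "(\<Sum>i\<in>W. c i * r x i) = (\<Sum>i\<in>W. w i * (\<Sum>j\<in>W. l i j * (s j * x j)))"
      by (intro sum.cong) (simp_all add: ls c_def)
    also have "\<dots> = (\<Sum>i\<in>W. \<Sum>j\<in>W. l j i * w i * (s j * x j))"
      by (simp only: row)
    also have "\<dots> = (\<Sum>j\<in>W. \<Sum>i\<in>W. l j i * w i * (s j * x j))"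
      by (rule sum.swap)
    also have "\<dots> = (\<Sum>j\<in>W. \<mu> * (c j * x j))"
      by (intro sum.cong) (simp_all add: eigen c_def flip: sum_distrib_right)
    also have "\<dots> = \<mu> * (\<Sum>j\<in>W. c j * x j)"
      by (rule sum_distrib_left[symmetric])
    finally have r: "(\<Sum>i\<in>W. c i * r x i) = \<mu> * (\<Sum>i\<in>W. c i * x i)" .
    have "c i * averaging_step \<alpha> N x i = c i * x i - \<alpha> * (c i * r x i)" for i
      unfolding averaging_step_eq_diff[of N i, OF fin] r_def by (simp add: algebra_simps)
    then have "(\<Sum>i\<in>W. c i * averaging_step \<alpha> N x i) = (\<Sum>i\<in>W. c i * x i) - \<alpha> * (\<Sum>i\<in>W. c i * r x i)"
      by (simp only: sum_subtractf sum_distrib_left)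
    then show ?thesis
      by (simp add: r left_diff_distrib)
  qed
  ultimately show ?thesis
    using that[OF \<mu>] by (simp add: N_def)
qed

section \<open>Fast convergence and communities\<close>

text \<open>
  The rate in \<^const>\<open>fast_convergence\<close> may be negative.  In that case the bound at time 1 forces
  \<open>M = 0\<close>, and the rate can be replaced by 0.
\<close>

lemma fast_convergenceE:
  assumes "fast_convergence V E \<alpha> R \<rho> x0" "0 < \<rho>" "V \<noteq> {}"
  obtains r M where "0 \<le> r" "r < \<rho>"
    "\<And>i t. i \<in> V \<Longrightarrow>
      \<bar>opinion V E \<alpha> R \<rho> x0 t i - limit_opinion V E \<alpha> R \<rho> x0 i\<bar> \<le> M * r ^ t"
proof -
  let ?d = "\<lambda>i t. \<bar>opinion V E \<alpha> R \<rho> x0 t i - limit_opinion V E \<alpha> R \<rho> x0 i\<bar>"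
  obtain r M where r: "r < \<rho>" "M \<ge> 0" "\<And>i t. i \<in> V \<Longrightarrow> ?d i t \<le> M * r ^ t"
    using assms(1) unfolding fast_convergence_def by blast
  show thesis
  proof (cases "0 \<le> r")
    case True
    then show thesis using that r by blast
  next
    case False
    obtain k where "k \<in> V" using assms(3) by blast
    then have "0 \<le> M * r"
      using r(3)[of k 1] abs_ge_zero[of "opinion V E \<alpha> R \<rho> x0 1 k - limit_opinion V E \<alpha> R \<rho> x0 k"]
      by (simp del: opinion.simps)
    then have "M = 0"
      using False r(2) by (auto simp: zero_le_mult_iff)
    then show thesis
      using that[of 0 0] r(3) assms(2) by simp
  qed
qed

text \<open>
  For equal limits the distance is at most \<open>2 * M * r ^ t\<close>, which is of smaller order than
  \<open>R * \<rho> ^ t\<close>.  For different limits the distance has a positive limit while \<open>R * \<rho> ^ t\<close> tends to 0.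
\<close>

lemma eventually_close_iff_same_limit:
  fixes x :: "nat \<Rightarrow> 'a \<Rightarrow> real"
  assumes V: "finite V" and r: "0 \<le> r" "r < \<rho>" "\<rho> < 1" and R: "0 < R"
    and bound: "\<And>i t. i \<in> V \<Longrightarrow> \<bar>x t i - L i\<bar> \<le> M * r ^ t"
  shows "\<forall>\<^sub>F t in sequentially. \<forall>i\<in>V. \<forall>j\<in>V. \<bar>x t i - x t j\<bar> \<le> R * \<rho> ^ t \<longleftrightarrow> L i = L j"
proof -
  have "\<forall>\<^sub>F t in sequentially. \<bar>x t i - x t j\<bar> \<le> R * \<rho> ^ t \<longleftrightarrow> L i = L j"
    if ij: "i \<in> V" "j \<in> V" for i j
  proof (cases "L i = L j")
    case True
    have "(\<lambda>t. 2 * M * (r / \<rho>) ^ t) \<longlonglongrightarrow> 2 * M * 0"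
      using r by (intro tendsto_intros LIMSEQ_power_zero) auto
    then have "\<forall>\<^sub>F t in sequentially. 2 * M * (r / \<rho>) ^ t < R"
      using R by (intro order_tendstoD) auto
    then show ?thesis
    proof eventually_elim
      case (elim t)
      have "\<bar>x t i - x t j\<bar> \<le> 2 * M * r ^ t"
        using bound[OF ij(1), of t] bound[OF ij(2), of t] True by linarith
      also have "\<dots> = 2 * M * (r / \<rho>) ^ t * \<rho> ^ t"
        using r by (simp add: power_divide)
      also have "\<dots> \<le> R * \<rho> ^ t"
        using elim r by (intro mult_right_mono) auto
      finally show ?case using True by simp
    qed
  next
    case False
    have lim: "(\<lambda>t. x t k) \<longlonglongrightarrow> L k" if "k \<in> V" for k
    proof -
      have "(\<lambda>t. M * r ^ t) \<longlonglongrightarrow> M * 0"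
        using r by (intro tendsto_intros LIMSEQ_power_zero) auto
      then have "(\<lambda>t. M * r ^ t) \<longlonglongrightarrow> 0"
        by simp
      with always_eventually have "(\<lambda>t. x t k - L k) \<longlonglongrightarrow> 0"
        by (rule Lim_null_comparison) (simp add: bound[OF that])
      then show ?thesis
        by (rule LIM_zero_cancel)
    qed
    have "(\<lambda>t. \<bar>x t i - x t j\<bar> - R * \<rho> ^ t) \<longlonglongrightarrow> \<bar>L i - L j\<bar> - R * 0"
      using r by (intro tendsto_intros lim ij LIMSEQ_power_zero) auto
    then have "\<forall>\<^sub>F t in sequentially. 0 < \<bar>x t i - x t j\<bar> - R * \<rho> ^ t"
      using False by (intro order_tendstoD) auto
    then show ?thesis
      by eventually_elim (use False in simp)
  qed
  then show ?thesis
    using V by (simp add: eventually_ball_finite)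
qed

text \<open>
  Comparing the growth \<open>\<kappa> ^ s\<close> after time \<open>T\<close> with the bound gives that \<open>\<bar>f T\<bar>\<close> is at most a constant
  times \<open>(r / \<rho>) ^ s\<close> for all \<open>s\<close>.
\<close>

lemma geometric_recurrence_zero:
  fixes f :: "nat \<Rightarrow> real"
  assumes rec: "\<And>t. T \<le> t \<Longrightarrow> f (Suc t) = \<kappa> * f t" and \<kappa>: "\<rho> \<le> \<kappa>"
    and r: "0 \<le> r" "r < \<rho>" and bound: "\<And>t. \<bar>f t\<bar> \<le> C * r ^ t"
  shows "f T = 0"
proof -
  have f: "f (T + s) = \<kappa> ^ s * f T" for s
    by (induction s) (simp_all add: rec)
  have "\<bar>f T\<bar> \<le> C * r ^ T * (r / \<rho>) ^ s" for s
  proof -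
    have "\<bar>f T\<bar> * \<rho> ^ s \<le> \<bar>f T\<bar> * \<kappa> ^ s"
      using \<kappa> r by (intro mult_left_mono power_mono) auto
    also have "\<dots> = \<bar>f (T + s)\<bar>"
      using \<kappa> r by (simp add: f abs_mult)
    also have "\<dots> \<le> C * r ^ T * r ^ s"
      using bound[of "T + s"] by (simp add: power_add mult.assoc)
    finally show ?thesis
      using r by (simp add: power_divide field_simps)
  qed
  moreover have "(\<lambda>s. C * r ^ T * (r / \<rho>) ^ s) \<longlonglongrightarrow> C * r ^ T * 0"
    using r by (intro tendsto_intros LIMSEQ_power_zero) auto
  ultimately have "\<bar>f T\<bar> \<le> C * r ^ T * 0"
    by (intro LIMSEQ_le_const[of "\<lambda>s. C * r ^ T * (r / \<rho>) ^ s"]) auto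
  then show ?thesis by simp
qed

lemma equiv_same_value: "equiv V {(i, j) \<in> V \<times> V. f i = f j}"
  by (auto simp: equiv_def refl_on_def sym_def trans_def)

lemma communities_partition: "partition_on V (communities V E \<alpha> R \<rho> x0)"
  unfolding communities_def by (intro partition_on_quotient equiv_same_value)

section \<open>Exceptional initial opinions\<close>

text \<open>
  The initial opinions to be excluded are those for which the functional \<open>c\<close> of
  \<open>laplacian_eigenfunctional\<close> vanishes at some time.  For all others, \<open>I\<close> cannot be a community of a
  fast convergent trajectory: once the neighbourhoods have settled, the functional is multiplied by
  a factor of at least \<open>\<rho>\<close> per step, but it decays like \<open>r ^ t\<close>.
\<close>

lemma AE_not_community:
  assumes V: "finite V" and E: "sym E" "irrefl E"
    and \<alpha>: "0 < \<alpha>" "\<alpha> < 1 / 2" and \<rho>: "0 < \<rho>" "\<rho> < 1" and R: "0 < R"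
    and I: "I \<subseteq> V" "2 \<le> card I"
    and gap: "\<rho> \<le> 1 - \<alpha> * \<mu>\<^sub>2 (normalized_laplacian I (induced_edges E I))"
  shows "AE x0 in (\<Pi>\<^sub>M i\<in>V. lborel).
    fast_convergence V E \<alpha> R \<rho> x0 \<longrightarrow> I \<notin> communities V E \<alpha> R \<rho> x0"
proof -
  let ?F = "induced_edges E I"
  let ?N = "\<lambda>i. {j \<in> I. (i, j) \<in> ?F}"
  have fin: "finite I"
    using V I finite_subset by blast
  have F: "sym ?F" "irrefl ?F"
    using E by (auto simp: induced_edges_def sym_def irrefl_def)
  obtain \<mu> c where \<mu>: "\<mu> \<le> \<mu>\<^sub>2 (normalized_laplacian I ?F)"
    and c: "\<exists>i\<in>I. c i \<noteq> 0" "(\<Sum>i\<in>I. c i) = 0"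
    and eigen: "\<And>\<alpha> x. (\<Sum>i\<in>I. c i * averaging_step \<alpha> ?N x i) = (1 - \<alpha> * \<mu>) * (\<Sum>i\<in>I. c i * x i)"
    by (rule laplacian_eigenfunctional[OF fin I(2) F]) blast
  have "\<alpha> * \<mu> \<le> \<alpha> * \<mu>\<^sub>2 (normalized_laplacian I ?F)"
    using \<mu> \<alpha> by (intro mult_left_mono) auto
  then have \<kappa>: "\<rho> \<le> 1 - \<alpha> * \<mu>"
    using gap by linarith
  define c' where "c' i = (if i \<in> I then c i else 0)" for i
  have c': "(\<Sum>i\<in>V. c' i * x i) = (\<Sum>i\<in>I. c i * x i)" for x :: "nat \<Rightarrow> real"
    using V I by (intro sum.mono_neutral_cong_right) (auto simp: c'_def)
  have "\<exists>i\<in>V. c' i \<noteq> 0"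
    using c(1) I by (auto simp: c'_def)
  then have "AE x0 in (\<Pi>\<^sub>M i\<in>V. lborel). \<forall>t. (\<Sum>i\<in>I. c i * opinion V E \<alpha> R \<rho> x0 t i) \<noteq> 0"
    using AE_opinion_avoids_hyperplane[OF V \<alpha>, of c'] unfolding c' AE_all_countable by blast
  then show ?thesis
  proof (rule AE_mp, intro AE_I2 impI notI)
    fix x0
    let ?x = "opinion V E \<alpha> R \<rho> x0" and ?L = "limit_opinion V E \<alpha> R \<rho> x0"
    assume nonzero: "\<forall>t. (\<Sum>i\<in>I. c i * ?x t i) \<noteq> 0"
      and fast: "fast_convergence V E \<alpha> R \<rho> x0" and comm: "I \<in> communities V E \<alpha> R \<rho> x0"
    obtain k where k: "I = {j \<in> V. ?L j = ?L k}"
      using comm unfolding communities_def quotient_def by (auto simp: eq_commute)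
    have "V \<noteq> {}"
      using I by auto
    with fast \<rho>(1) obtain r M where r: "0 \<le> r" "r < \<rho>"
      and bound: "\<And>i t. i \<in> V \<Longrightarrow> \<bar>?x t i - ?L i\<bar> \<le> M * r ^ t"
      by (rule fast_convergenceE) blast
    obtain T where T: "\<And>t i j. \<lbrakk>T \<le> t; i \<in> V; j \<in> V\<rbrakk> \<Longrightarrow> \<bar>?x t i - ?x t j\<bar> \<le> R * \<rho> ^ t \<longleftrightarrow> ?L i = ?L j"
      using eventually_close_iff_same_limit[OF V r \<rho>(2) R, of ?x ?L M] bound
      unfolding eventually_sequentially by blast
    have "(\<Sum>i\<in>I. c i * ?x (Suc t) i) = (1 - \<alpha> * \<mu>) * (\<Sum>i\<in>I. c i * ?x t i)" if "T \<le> t" for t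
    proof -
      have "nbrs V E (R * \<rho> ^ t) (?x t) i = ?N i" if "i \<in> I" for i
        using T[OF \<open>T \<le> t\<close>, of i] that by (auto simp: nbrs_def induced_edges_def k)
      then have "?x (Suc t) i = averaging_step \<alpha> ?N (?x t) i" if "i \<in> I" for i
        using that unfolding opinion_Suc averaging_step_def by (simp only:)
      then show ?thesis
        unfolding eigen[symmetric] by (intro sum.cong) auto
    qed
    moreover have "\<bar>\<Sum>i\<in>I. c i * ?x t i\<bar> \<le> ((\<Sum>i\<in>I. \<bar>c i\<bar>) * M) * r ^ t" for t
    proof -
      have "(\<Sum>i\<in>I. c i * ?L i) = (\<Sum>i\<in>I. c i * ?L k)"
        by (intro sum.cong) (auto simp: k)
      then have "(\<Sum>i\<in>I. c i * ?x t i) = (\<Sum>i\<in>I. c i * (?x t i - ?L i))"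
        using c(2) by (simp add: right_diff_distrib sum_subtractf flip: sum_distrib_right)
      also have "\<bar>\<dots>\<bar> \<le> (\<Sum>i\<in>I. \<bar>c i\<bar> * (M * r ^ t))"
      proof (rule order_trans[OF sum_abs sum_mono])
        fix i assume "i \<in> I"
        then show "\<bar>c i * (?x t i - ?L i)\<bar> \<le> \<bar>c i\<bar> * (M * r ^ t)"
          using bound[of i t] I unfolding abs_mult by (intro mult_left_mono) auto
      qed
      finally show ?thesis
        by (simp add: mult.assoc flip: sum_distrib_right)
    qed
    ultimately have "(\<Sum>i\<in>I. c i * ?x T i) = 0"
      using geometric_recurrence_zero[of T "\<lambda>t. \<Sum>i\<in>I. c i * ?x t i", OF _ \<kappa> r] by blast
    then show False
      using nonzero by blast
  qed
qed

theorem corollary1: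
  fixes n :: nat and V :: "nat set" and E :: "(nat \<times> nat) set"
    and \<alpha> \<delta> R \<rho> :: real
  assumes "n \<ge> 2" and "V = {1..n}"
    and "E \<subseteq> V \<times> V" and "sym E" and "irrefl E"
    and "0 < \<alpha>" and "\<alpha> < 1 / 2"
    and "0 < \<delta>" and "\<delta> \<le> 1"
    and "R > 0"
    and "\<rho> = 1 - \<alpha> * \<delta>"
  shows "AE x0 in (\<Pi>\<^sub>M i\<in>V. lborel).
    fast_convergence V E \<alpha> R \<rho> x0 \<longrightarrow>
      partition_on V (communities V E \<alpha> R \<rho> x0) \<and>
      (\<forall>I \<in> communities V E \<alpha> R \<rho> x0. card I \<ge> 2 \<longrightarrow>
        \<mu>\<^sub>2 (normalized_laplacian I (induced_edges E I)) > \<delta>)"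
proof -
  let ?\<mu> = "\<lambda>I. \<mu>\<^sub>2 (normalized_laplacian I (induced_edges E I))"
  let ?B = "{I \<in> Pow V. 2 \<le> card I \<and> ?\<mu> I \<le> \<delta>}"
  have V: "finite V"
    using assms(2) by simp
  have "\<alpha> * \<delta> \<le> \<alpha> * 1"
    using assms(6,9) by (intro mult_left_mono) auto
  moreover have "0 < \<alpha> * \<delta>"
    using assms(6,8) by simp
  ultimately have \<rho>: "0 < \<rho>" "\<rho> < 1"
    using assms(7,11) by linarith+
  have "AE x0 in (\<Pi>\<^sub>M i\<in>V. lborel).
      fast_convergence V E \<alpha> R \<rho> x0 \<longrightarrow> I \<notin> communities V E \<alpha> R \<rho> x0" if "I \<in> ?B" for I
  proof (rule AE_not_community)
    show "\<rho> \<le> 1 - \<alpha> * ?\<mu> I"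
      unfolding assms(11) using that assms(6) by simp
  qed (use that V \<rho> assms in auto)
  then have "AE x0 in (\<Pi>\<^sub>M i\<in>V. lborel). \<forall>I\<in>?B.
      fast_convergence V E \<alpha> R \<rho> x0 \<longrightarrow> I \<notin> communities V E \<alpha> R \<rho> x0"
    using V by (intro AE_finite_allI) auto
  then show ?thesis
  proof (rule AE_mp, intro AE_I2 impI conjI ballI)
    fix x0 I
    assume *: "\<forall>I\<in>?B. fast_convergence V E \<alpha> R \<rho> x0 \<longrightarrow> I \<notin> communities V E \<alpha> R \<rho> x0"
      and fast: "fast_convergence V E \<alpha> R \<rho> x0"
      and I: "I \<in> communities V E \<alpha> R \<rho> x0" "2 \<le> card I"
    have "I \<subseteq> V"
      using partition_onD1[OF communities_partition[of V E \<alpha> R \<rho> x0]] I(1) by blast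
    show "\<delta> < ?\<mu> I"
    proof (rule ccontr)
      assume "\<not> \<delta> < ?\<mu> I"
      then have "I \<in> ?B"
        using \<open>I \<subseteq> V\<close> I(2) by simp
      with * fast I(1) show False
        by blast
    qed
  qed (rule communities_partition)
qed

end
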